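(* Assume $K(x,y)>0$, $\mu(x)>0$, $\nu(y)>0$ for all $x,y\in S$. Let $g:S\to\mathbb R$, let $\varphi_s^g=e^{(1-s)Q}e^g$ for $s\in[0,1]$ (so $\varphi_s^g>0$ on $S$), and define for $x\ne y$ $$Q_s^g(x,y)=Q(x,y)\frac{\varphi_s^g(y)}{\varphi_s^g(x)},$$ with diagonal entries chosen so that rows sum to zero. Let $\mathbf P^g$ be the law on $\Omega$ of the time-inhomogeneous Markov chain on $[0,1]$ generated by $(Q_s^g)_{s\in[0,1]}$ and initialized from $X_0\sim\mu$. Then $\mathbf P^g$ has endpoint coupling $\pi_g$, i.e. $\mathbf P^g(X_0=x,X_1=y)=\pi_g(x,y)$ for all $x,y\in S$, and has the same conditional bridges as the reference process, i.e. $\mathbf P^g(\cdot\mid X_0=x,X_1=y)=\mathbf R_\mu(\cdot\mid X_0=x,X_1=y)$ for all $x,y\in S$. Equivalently, $$\mathbf P^g(d\omega)=\sum_{x,y\in S}\pi_g(x,y)\,\mathbf R_\mu(d\omega\mid X_0=x,X_1=y).$$ In particular, for $g=g^\star$, the unique element of $\mathcal H$ with $m_{g^\star}=\nu$, the path measure $\mathbf P^{g^\star}$ is the Schrödinger bridge between $\mu$ and $\nu$ relative to $\mathbf R_\mu$.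
   Context: Let $N\ge1$ be an integer and $S=\{1,\dots,N\}$. Let $Q\in\mathbb R^{N\times N}$ be the generator of a continuous-time Markov chain on $S$ (nonnegative off-diagonal entries, rows summing to zero) and $K=e^{Q}$. Let $\mu,\nu$ be probability distributions on $S$. In $e^{(1-s)Q}e^g$, $e^g$ denotes the vector $(e^{g(y)})_{y\in S}$. For $g\in\mathbb R^S$ set $Z_g(x)=\sum_{z\in S}K(x,z)e^{g(z)}$, $p_g(y|x)=\frac{K(x,y)e^{g(y)}}{Z_g(x)}$, $\pi_g(x,y)=\mu(x)p_g(y|x)$ and $m_g(y)=\sum_{x\in S}\pi_g(x,y)$. The gauge-fixed space is $\mathcal H=\{g\in\mathbb R^S:\sum_{y\in S}\nu(y)g(y)=0\}$; there is a unique $g^\star\in\mathcal H$ with $m_{g^\star}=\nu$. Let $\Omega=D([0,1],S)$ be the Skorokhod space of càdlàg paths with values in $S$, with coordinate process $(X_t)_{t\in[0,1]}$, and let $\mathbf R_\mu$ be the law on $\Omega$ of the continuous-time Markov chain with generator $Q$ and $X_0\sim\mu$, so that $\mathbf R_\mu(X_0=x,X_1=y)=\mu(x)K(x,y)$. The Schrödinger bridge between $\mu$ and $\nu$ relative to $\mathbf R_\mu$ is the unique minimizer of the relative entropy $\operatorname{KL}(\mathbf P\,\|\,\mathbf R_\mu)$ over all probability measures $\mathbf P$ on $\Omega$ with $\mathbf P\ll\mathbf R_\mu$, with law of $X_0$ under $\mathbf P$ equal to $\mu$ and law of $X_1$ under $\mathbf P$ equal to $\nu$. *)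

theory Defs
  imports "HOL-Probability.Probability"
begin

text \<open>
  The state space \<open>S = {1, \<dots>, N}\<close> is a finite type \<open>'n\<close> with \<open>N = CARD('n)\<close>; \<open>\<real>\<^sup>S\<close> is \<open>real ^ 'n\<close>.
\<close>

section \<open>Generators and the matrix exponential\<close>

definition is_generator :: "real^'n^'n \<Rightarrow> bool" where
  "is_generator Q \<longleftrightarrow>
     (\<forall>x y. x \<noteq> y \<longrightarrow> 0 \<le> Q $ x $ y) \<and> (\<forall>x. (\<Sum>y\<in>UNIV. Q $ x $ y) = 0)"

text \<open>
  The instance of \<open>times\<close> for \<open>real^'n^'n\<close> is componentwise, so \<open>A ^ k\<close> is not the matrix power,
  and \<open>exp\<close> is not available at this type.
\<close>

definition matrix_power :: "real^'n^'n \<Rightarrow> nat \<Rightarrow> real^'n^'n" where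
  "matrix_power A k = (((**) A) ^^ k) (mat 1)"

definition matrix_exp :: "real^'n^'n \<Rightarrow> real^'n^'n" where
  "matrix_exp A = (\<Sum>k. (1 / fact k) *\<^sub>R matrix_power A k)"

definition vec_exp :: "real^'n \<Rightarrow> real^'n" where
  "vec_exp g = (\<chi> y. exp (g $ y))"


section \<open>The couplings\<close>

definition partition_fun :: "real^'n^'n \<Rightarrow> real^'n \<Rightarrow> 'n \<Rightarrow> real" where
  "partition_fun Q g x = (\<Sum>z\<in>UNIV. matrix_exp Q $ x $ z * exp (g $ z))"

definition tilted_kernel :: "real^'n^'n \<Rightarrow> real^'n \<Rightarrow> 'n \<Rightarrow> 'n \<Rightarrow> real" where
  "tilted_kernel Q g x y = matrix_exp Q $ x $ y * exp (g $ y) / partition_fun Q g x"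

definition coupling :: "real^'n^'n \<Rightarrow> 'n pmf \<Rightarrow> real^'n \<Rightarrow> 'n \<Rightarrow> 'n \<Rightarrow> real" where
  "coupling Q \<mu> g x y = pmf \<mu> x * tilted_kernel Q g x y"

definition second_marginal :: "real^'n^'n \<Rightarrow> 'n pmf \<Rightarrow> real^'n \<Rightarrow> 'n \<Rightarrow> real" where
  "second_marginal Q \<mu> g y = (\<Sum>x\<in>UNIV. coupling Q \<mu> g x y)"

definition gauge_space :: "'n::finite pmf \<Rightarrow> (real^'n) set" where
  "gauge_space \<nu> = {g. (\<Sum>y\<in>UNIV. pmf \<nu> y * g $ y) = 0}"


section \<open>The tilted generators\<close>

definition space_time_fun :: "real^'n^'n \<Rightarrow> real^'n \<Rightarrow> real \<Rightarrow> real^'n" where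
  "space_time_fun Q g s = matrix_exp ((1 - s) *\<^sub>R Q) *v vec_exp g"

definition tilted_rate :: "real^'n^'n \<Rightarrow> real^'n \<Rightarrow> real \<Rightarrow> 'n \<Rightarrow> 'n \<Rightarrow> real" where
  "tilted_rate Q g s x y = Q $ x $ y * (space_time_fun Q g s $ y / space_time_fun Q g s $ x)"

definition tilted_generator :: "real^'n^'n \<Rightarrow> real^'n \<Rightarrow> real \<Rightarrow> real^'n^'n" where
  "tilted_generator Q g s =
     (\<chi> x y. if x \<noteq> y then tilted_rate Q g s x y
             else - (\<Sum>z\<in>UNIV - {x}. tilted_rate Q g s x z))"


section \<open>Path space\<close>

text \<open>
  Paths are \<open>undefined\<close> outside \<open>[0,1]\<close>.  As \<open>'n\<close> is discrete, a one-sided limit \<open>x\<close> at \<open>t\<close>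
  exists iff the path eventually takes the value \<open>x\<close> on that side of \<open>t\<close>.
\<close>

definition skorokhod_paths :: "(real \<Rightarrow> 'n) set" where
  "skorokhod_paths =
     {\<omega> \<in> extensional {0..1}.
        (\<forall>t\<in>{0..<1}. \<forall>\<^sub>F s in at_right t. \<omega> s = \<omega> t) \<and>
        (\<forall>t\<in>{0<..1}. \<exists>x. \<forall>\<^sub>F s in at_left t. \<omega> s = x)}"

text \<open>
  \<open>path_events T\<close> carries the \<open>\<sigma>\<close>-algebra generated by the coordinates \<open>X\<^sub>t\<close> with \<open>t \<in> T\<close>.  For
  \<open>T = [0,1]\<close> this is the Borel \<open>\<sigma>\<close>-algebra of the Skorokhod topology, and \<open>T = [0,s]\<close> gives the
  natural filtration.
\<close>

definition path_events :: "real set \<Rightarrow> (real \<Rightarrow> 'n) measure" where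
  "path_events T = sigma skorokhod_paths {{\<omega> \<in> skorokhod_paths. \<omega> t = x} | t x. t \<in> T}"

abbreviation path_space :: "(real \<Rightarrow> 'n) measure" where
  "path_space \<equiv> path_events {0..1}"

definition path_law :: "(real \<Rightarrow> 'n) measure \<Rightarrow> bool" where
  "path_law P \<longleftrightarrow> prob_space P \<and> sets P = sets path_space"

definition has_marginal :: "(real \<Rightarrow> 'n) measure \<Rightarrow> real \<Rightarrow> 'n pmf \<Rightarrow> bool" where
  "has_marginal P t \<mu> \<longleftrightarrow> distr P (count_space UNIV) (\<lambda>\<omega>. \<omega> t) = measure_pmf \<mu>"

text \<open>
  The conditional law given \<open>X\<^sub>0 = x\<close> and \<open>X\<^sub>1 = y\<close>: \<open>uniform_measure P A\<close> is \<open>B \<mapsto> P (A \<inter> B) / P A\<close>.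
\<close>

definition bridge :: "(real \<Rightarrow> 'n) measure \<Rightarrow> 'n \<Rightarrow> 'n \<Rightarrow> (real \<Rightarrow> 'n) measure" where
  "bridge P x y = uniform_measure P {\<omega> \<in> space P. \<omega> 0 = x \<and> \<omega> 1 = y}"


section \<open>Markov chains generated by a family of generators\<close>

text \<open>
  The transition matrices \<open>U s t\<close> (from time \<open>s\<close> to time \<open>t\<close>) of the chain generated by \<open>(G\<^sub>t)\<close>
  solve the Kolmogorov forward equation; the solution is unique for continuous \<open>G\<close>.
\<close>

definition transition_family ::
    "(real \<Rightarrow> real^'n^'n) \<Rightarrow> (real \<Rightarrow> real \<Rightarrow> real^'n^'n) \<Rightarrow> bool" where
  "transition_family G U \<longleftrightarrow>
     (\<forall>s\<in>{0..1}. U s s = mat 1 \<and>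
        (\<forall>t\<in>{s..1}. (U s has_vector_derivative U s t ** G t) (at t within {s..1})))"

text \<open>
  The last clause is the Markov property with respect to the natural filtration:
  \<open>P (X\<^sub>t = y | F\<^sub>s) = U s t (X\<^sub>s, y)\<close>, integrated over \<open>A \<inter> {X\<^sub>s = x}\<close> for \<open>A \<in> F\<^sub>s\<close>.
\<close>

definition markov_law ::
    "'n::finite pmf \<Rightarrow> (real \<Rightarrow> real^'n^'n) \<Rightarrow> (real \<Rightarrow> 'n) measure \<Rightarrow> bool" where
  "markov_law \<mu> G P \<longleftrightarrow>
     path_law P \<and> has_marginal P 0 \<mu> \<and>
     (\<exists>U. transition_family G U \<and>
        (\<forall>s t x y. \<forall>A\<in>sets (path_events {0..s}). 0 \<le> s \<and> s \<le> t \<and> t \<le> 1 \<longrightarrow>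
           measure P {\<omega> \<in> A. \<omega> s = x \<and> \<omega> t = y} =
           measure P {\<omega> \<in> A. \<omega> s = x} * U s t $ x $ y))"


section \<open>Schroedinger bridges\<close>

text \<open>
  The library's \<open>KL_divergence b R P\<close> (for the divergence of \<open>P\<close> from \<open>R\<close>) is a Bochner integral,
  hence \<open>0\<close> when the log-density is not \<open>P\<close>-integrable.  The negative part of the log-density is
  always \<open>P\<close>-integrable for \<open>P \<lless> R\<close>, so the true value is then \<open>\<infinity>\<close>.
\<close>

definition relative_entropy :: "'a measure \<Rightarrow> 'a measure \<Rightarrow> ereal" where
  "relative_entropy P R =
     (if absolutely_continuous R P \<and> integrable P (entropy_density (exp 1) R P)
      then ereal (KL_divergence (exp 1) R P) else \<infinity>)"

definition bridge_candidates ::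
    "(real \<Rightarrow> 'n) measure \<Rightarrow> 'n pmf \<Rightarrow> 'n pmf \<Rightarrow> (real \<Rightarrow> 'n) measure set" where
  "bridge_candidates R \<mu> \<nu> =
     {P. path_law P \<and> absolutely_continuous R P \<and> has_marginal P 0 \<mu> \<and> has_marginal P 1 \<nu>}"

definition schroedinger_bridge ::
    "(real \<Rightarrow> 'n) measure \<Rightarrow> 'n pmf \<Rightarrow> 'n pmf \<Rightarrow> (real \<Rightarrow> 'n) measure \<Rightarrow> bool" where
  "schroedinger_bridge R \<mu> \<nu> P \<longleftrightarrow>
     P \<in> bridge_candidates R \<mu> \<nu> \<and>
     (\<forall>P'\<in>bridge_candidates R \<mu> \<nu>. P' \<noteq> P \<longrightarrow> relative_entropy P R < relative_entropy P' R)"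

end

theory Submission
  imports Defs
begin

text \<open>
  The tilted chain is the Doob transform of the reference chain by the space-time function
  \<open>\<phi>\<^sub>s = e\<^bsup>(1-s)Q\<^esup> e\<^sup>g\<close>, which solves the backward equation \<open>\<phi>' = - Q\<phi>\<close>.  Its transition matrices are
  therefore \<open>e\<^bsup>(t-s)Q\<^esup>(x,y) \<phi>\<^sub>t(y) / \<phi>\<^sub>s(x)\<close> (lemma \<open>transition_family_tilted\<close>).  Along the times of a
  cylinder event these factors telescope, and only \<open>\<phi>\<^sub>1(X\<^sub>1) / \<phi>\<^sub>0(X\<^sub>0) = e\<^bsup>g(X\<^sub>1)\<^esup> / Z\<^sub>g(X\<^sub>0)\<close> survives
  (lemma \<open>tilted_cylinder\<close>).  So the tilted law has a density with respect to the reference law that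
  is a function of the two endpoints (lemmas \<open>tilted_on_endpoint_event\<close> and \<open>tilted_eq_density\<close>):
  conditioning on the endpoints cancels it, which gives equal bridges, and multiplying it with
  \<open>\<mu>(x) K(x,y)\<close> gives the endpoint coupling.
  
  For the variational statement, the logarithm of this density is \<open>g(X\<^sub>1) - ln Z\<^sub>g(X\<^sub>0)\<close>.  Its mean is the
  same under all laws with the prescribed marginals, and an entropy identity of Pythagorean type
  (lemma \<open>relative_entropy_unique_min\<close>) shows that the tilted law beats every other candidate
  strictly.
\<close>

section \<open>The matrix exponential\<close>

lemma matrix_power_Suc: "matrix_power A (Suc k) = A ** matrix_power A k"
  by (simp add: matrix_power_def)

lemma matrix_power_scaleR: "matrix_power (t *\<^sub>R A) k = t ^ k *\<^sub>R matrix_power A k"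
  by (induction k)
     (simp_all add: matrix_power_def matrix_matrix_mult_def vec_eq_iff sum_distrib_left mult_ac)

text \<open>
  The sum of the absolute values of all entries dominates every absolute row sum; this crude
  geometric bound is enough to dominate the exponential series.
\<close>

lemma abs_matrix_power_le:
  fixes A :: "real^'n^'n"
  shows "\<bar>matrix_power A k $ x $ y\<bar> \<le> (\<Sum>i\<in>UNIV. \<Sum>j\<in>UNIV. \<bar>A $ i $ j\<bar>) ^ k"
proof (induction k arbitrary: x)
  case 0
  then show ?case by (simp add: matrix_power_def mat_def)
next
  case (Suc k)
  let ?C = "\<Sum>i\<in>UNIV. \<Sum>j\<in>UNIV. \<bar>A $ i $ j\<bar>"
  have "\<bar>matrix_power A (Suc k) $ x $ y\<bar> \<le> (\<Sum>z\<in>UNIV. \<bar>A $ x $ z * matrix_power A k $ z $ y\<bar>)"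
    by (simp add: matrix_power_Suc matrix_matrix_mult_def)
  also have "\<dots> \<le> (\<Sum>z\<in>UNIV. \<bar>A $ x $ z\<bar> * ?C ^ k)"
    unfolding abs_mult by (intro sum_mono mult_left_mono Suc.IH) simp
  also have "\<dots> = (\<Sum>z\<in>UNIV. \<bar>A $ x $ z\<bar>) * ?C ^ k"
    by (simp add: sum_distrib_right)
  also have "\<dots> \<le> ?C * ?C ^ k"
    by (intro mult_right_mono member_le_sum zero_le_power sum_nonneg) auto
  finally show ?case by simp
qed

lemma summable_matrix_power_entry:
  fixes A :: "real^'n^'n"
  shows "summable (\<lambda>k. matrix_power A k $ x $ y / fact k * t ^ k)"
proof (rule summable_comparison_test)
  let ?C = "\<Sum>i\<in>UNIV. \<Sum>j\<in>UNIV. \<bar>A $ i $ j\<bar>"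
  have "norm (matrix_power A k $ x $ y / fact k * t ^ k) \<le> inverse (fact k) * (?C * \<bar>t\<bar>) ^ k" for k
    using mult_right_mono[OF abs_matrix_power_le[of A k x y], of "\<bar>t\<bar> ^ k / fact k"]
    by (simp add: abs_mult power_abs power_mult_distrib divide_inverse mult_ac)
  then show "\<exists>N. \<forall>k\<ge>N. norm (matrix_power A k $ x $ y / fact k * t ^ k)
      \<le> inverse (fact k) * (?C * \<bar>t\<bar>) ^ k" by blast
  show "summable (\<lambda>k. inverse (fact k) * (?C * \<bar>t\<bar>) ^ k)"
    by (rule summable_exp)
qed

text \<open>
  Each entry of \<open>t \<mapsto> e\<^bsup>tA\<^esup>\<close> is a real power series in \<open>t\<close>, so differentiation reduces to the
  termwise differentiation of power series.
\<close>

lemma matrix_exp_scaleR_nth: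
  "matrix_exp (t *\<^sub>R A) $ x $ y = (\<Sum>k. matrix_power A k $ x $ y / fact k * t ^ k)"
proof -
  have "(\<lambda>k. (1 / fact k) *\<^sub>R matrix_power (t *\<^sub>R A) k)
      sums (\<chi> x y. \<Sum>k. matrix_power A k $ x $ y / fact k * t ^ k)"
    unfolding sums_def
  proof (intro vec_tendstoI)
    fix x y
    show "((\<lambda>n. (\<Sum>k<n. (1 / fact k) *\<^sub>R matrix_power (t *\<^sub>R A) k) $ x $ y) \<longlongrightarrow>
        (\<chi> x y. \<Sum>k. matrix_power A k $ x $ y / fact k * t ^ k) $ x $ y) sequentially"
      using summable_LIMSEQ[OF summable_matrix_power_entry[of A x y t]]
      by (simp add: matrix_power_scaleR mult_ac)
  qed
  from sums_unique[OF this, symmetric] show ?thesis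
    by (simp add: matrix_exp_def)
qed

lemma matrix_exp_0: "matrix_exp (0 :: real^'n^'n) = mat 1"
proof -
  have "matrix_exp (0 *\<^sub>R (0 :: real^'n^'n)) $ x $ y = mat 1 $ x $ y" for x y
    unfolding matrix_exp_scaleR_nth by (subst powser_zero) (simp add: matrix_power_def)
  then show ?thesis by (simp add: vec_eq_iff)
qed

lemma matrix_exp_scaleR_derivative:
  "((\<lambda>t. matrix_exp (t *\<^sub>R A) $ x $ y) has_real_derivative
     (\<Sum>z\<in>UNIV. A $ x $ z * matrix_exp (t *\<^sub>R A) $ z $ y)) (at t)"
proof -
  let ?c = "\<lambda>x k. matrix_power A k $ x $ y / fact k"
  have "diffs (?c x) k = (\<Sum>z\<in>UNIV. A $ x $ z * ?c z k)" for k
    by (simp add: diffs_def matrix_power_Suc matrix_matrix_mult_def sum_divide_distrib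
        sum_distrib_left del: of_nat_Suc)
  then have "(\<Sum>k. diffs (?c x) k * t ^ k) = (\<Sum>k. \<Sum>z\<in>UNIV. A $ x $ z * (?c z k * t ^ k))"
    by (simp add: sum_distrib_left sum_distrib_right mult_ac)
  also have "\<dots> = (\<Sum>z\<in>UNIV. \<Sum>k. A $ x $ z * (?c z k * t ^ k))"
    by (intro suminf_sum summable_mult summable_matrix_power_entry)
  also have "\<dots> = (\<Sum>z\<in>UNIV. A $ x $ z * matrix_exp (t *\<^sub>R A) $ z $ y)"
    unfolding matrix_exp_scaleR_nth
    by (intro sum.cong refl suminf_mult summable_matrix_power_entry)
  finally have *: "(\<Sum>k. diffs (?c x) k * t ^ k) =
    (\<Sum>z\<in>UNIV. A $ x $ z * matrix_exp (t *\<^sub>R A) $ z $ y)" .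
  show ?thesis
    using termdiffs_strong_converges_everywhere[of "?c x" t, OF summable_matrix_power_entry]
    unfolding * unfolding matrix_exp_scaleR_nth .
qed

section \<open>Forward equations and the Doob transform\<close>

text \<open>
  Uniqueness for the forward equation \<open>w' = w Q\<close> of a row vector: along a solution,
  \<open>r \<mapsto> w\<^sub>r e\<^bsup>(t-r)Q\<^esup>\<close> has derivative zero, because the term \<open>w\<^sub>r Q\<close> cancels against the derivative
  of the exponential.  Comparing \<open>r = s\<close> with \<open>r = t\<close> gives the formula.
\<close>

lemma forward_equation_unique:
  fixes w :: "real \<Rightarrow> 'n::finite \<Rightarrow> real"
  assumes w: "\<And>r z. r \<in> {s..t} \<Longrightarrow>
      ((\<lambda>r. w r z) has_real_derivative (\<Sum>u\<in>UNIV. w r u * Q $ u $ z)) (at r within {s..t})"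
    and "s \<le> t"
  shows "w t y = (\<Sum>z\<in>UNIV. w s z * matrix_exp ((t - s) *\<^sub>R Q) $ z $ y)"
proof -
  let ?E = "\<lambda>r. matrix_exp ((t - r) *\<^sub>R Q)"
  let ?F = "\<lambda>r. \<Sum>z\<in>UNIV. w r z * ?E r $ z $ y"
  have E: "((\<lambda>r. ?E r $ z $ y) has_real_derivative - (\<Sum>u\<in>UNIV. Q $ z $ u * ?E r $ u $ y))
      (at r within {s..t})" for r z
  proof -
    have "((\<lambda>r. t - r) has_real_derivative -1) (at r within {s..t})"
      by (auto intro!: derivative_eq_intros)
    from DERIV_chain2[OF matrix_exp_scaleR_derivative this] show ?thesis by simp
  qed
  have "(?F has_real_derivative 0) (at r within {s..t})" if r: "r \<in> {s..t}" for r
  proof -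
    have "(?F has_real_derivative (\<Sum>z\<in>UNIV. (\<Sum>u\<in>UNIV. w r u * Q $ u $ z) * ?E r $ z $ y
        + w r z * - (\<Sum>u\<in>UNIV. Q $ z $ u * ?E r $ u $ y))) (at r within {s..t})"
      by (rule DERIV_sum) (rule derivative_eq_intros w E r refl | simp)+
    moreover have "(\<Sum>z\<in>UNIV. (\<Sum>u\<in>UNIV. w r u * Q $ u $ z) * ?E r $ z $ y) =
        (\<Sum>z\<in>UNIV. w r z * (\<Sum>u\<in>UNIV. Q $ z $ u * ?E r $ u $ y))"
      unfolding sum_distrib_left sum_distrib_right
      by (subst sum.swap) (simp add: mult_ac)
    ultimately show ?thesis by (simp add: sum_subtractf)
  qed
  from has_field_derivative_zero_constant[OF _ this]
  obtain c where c: "\<forall>r\<in>{s..t}. ?F r = c" by auto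
  have "w t y = ?F t"
    by (simp add: matrix_exp_0 mat_def if_distrib[where f="\<lambda>a. _ * a"] cong: if_cong)
  also have "\<dots> = c" using \<open>s \<le> t\<close> by (intro c[THEN bspec]) simp
  also have "c = ?F s" using \<open>s \<le> t\<close> by (intro c[THEN bspec, symmetric]) simp
  finally show ?thesis .
qed

lemma transition_family_const:
  assumes U: "transition_family (\<lambda>_. Q) U" and "0 \<le> s" "s \<le> t" "t \<le> 1"
  shows "U s t = matrix_exp ((t - s) *\<^sub>R Q)"
proof -
  have "U s t $ x $ y = matrix_exp ((t - s) *\<^sub>R Q) $ x $ y" for x y
  proof -
    have "((\<lambda>r. U s r $ x $ z) has_real_derivative (\<Sum>u\<in>UNIV. U s r $ x $ u * Q $ u $ z))
        (at r within {s..t})" if "r \<in> {s..t}" for r z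
    proof -
      have "(U s has_vector_derivative U s r ** Q) (at r within {s..t})"
        using U that assms unfolding transition_family_def
        by (intro has_vector_derivative_within_subset[where S="{s..1}" and T="{s..t}"]) auto
      then have "((\<lambda>r. U s r $ x $ z) has_vector_derivative (U s r ** Q) $ x $ z) (at r within {s..t})"
        by (intro bounded_linear.has_vector_derivative[OF bounded_linear_vec_nth])
      then show ?thesis
        by (simp add: has_real_derivative_iff_has_vector_derivative matrix_matrix_mult_def)
    qed
    from forward_equation_unique[OF this \<open>s \<le> t\<close>] 
    show ?thesis using U assms
      by (simp add: transition_family_def mat_def if_distrib[where f="\<lambda>a. a * _"] cong: if_cong)
  qed
  then show ?thesis by (simp add: vec_eq_iff)
qed

lemma space_time_fun_derivative:
  "((\<lambda>s. space_time_fun Q g s $ x) has_real_derivative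
     - (\<Sum>z\<in>UNIV. Q $ x $ z * space_time_fun Q g s $ z)) (at s within T)"
proof -
  have "((\<lambda>s. matrix_exp ((1 - s) *\<^sub>R Q) $ x $ y) has_real_derivative
      - (\<Sum>z\<in>UNIV. Q $ x $ z * matrix_exp ((1 - s) *\<^sub>R Q) $ z $ y)) (at s within T)" for y
  proof -
    have "((\<lambda>r. 1 - r) has_real_derivative -1) (at s within T)"
      by (auto intro!: derivative_eq_intros)
    from DERIV_chain2[OF matrix_exp_scaleR_derivative this] show ?thesis by simp
  qed
  then have "((\<lambda>s. \<Sum>y\<in>UNIV. matrix_exp ((1 - s) *\<^sub>R Q) $ x $ y * exp (g $ y)) has_real_derivative
      (\<Sum>y\<in>UNIV. - (\<Sum>z\<in>UNIV. Q $ x $ z * matrix_exp ((1 - s) *\<^sub>R Q) $ z $ y) * exp (g $ y)))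
      (at s within T)"
    by (intro DERIV_sum DERIV_cmult_right)
  moreover have "(\<Sum>y\<in>UNIV. - (\<Sum>z\<in>UNIV. Q $ x $ z * matrix_exp ((1 - s) *\<^sub>R Q) $ z $ y) * exp (g $ y))
     = - (\<Sum>z\<in>UNIV. Q $ x $ z * space_time_fun Q g s $ z)"
    unfolding space_time_fun_def matrix_vector_mult_def vec_exp_def
    by (simp add: sum_distrib_left sum_distrib_right sum_negf mult_ac) (rule sum.swap)
  ultimately show ?thesis
    by (simp add: space_time_fun_def matrix_vector_mult_def vec_exp_def)
qed

text \<open>
  The Doob transform.  Conjugating \<open>V\<close> by the space-time function, that is, passing to
  \<open>\<phi>\<^sub>s(x) V\<^sub>s\<^sub>r(x,z) / \<phi>\<^sub>r(z)\<close>, turns the forward equation of the tilted generator into that of the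
  constant generator \<open>Q\<close>: the diagonal of the tilted generator contributes \<open>- (Q\<phi>)(z) / \<phi>(z)\<close>,
  and the backward equation \<open>\<phi>' = - Q\<phi>\<close> makes the derivative of \<open>1 / \<phi>\<close> cancel it.  Hence
  uniqueness is only needed for a constant generator.
\<close>

lemma transition_family_tilted:
  assumes pos: "\<And>s x. s \<in> {0..1} \<Longrightarrow> space_time_fun Q g s $ x > 0"
    and V: "transition_family (tilted_generator Q g) V" and st: "0 \<le> s" "s \<le> t" "t \<le> 1"
  shows "V s t $ x $ y = matrix_exp ((t - s) *\<^sub>R Q) $ x $ y *
    space_time_fun Q g t $ y / space_time_fun Q g s $ x"
proof -
  let ?p = "\<lambda>s x. space_time_fun Q g s $ x"
  define w where "w r z = ?p s x * V s r $ x $ z / ?p r z" for r z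
  have "((\<lambda>r. w r z) has_real_derivative (\<Sum>u\<in>UNIV. w r u * Q $ u $ z)) (at r within {s..t})"
    if r: "r \<in> {s..t}" for r z
  proof -
    let ?G = "tilted_generator Q g r"
    have p: "?p r u \<noteq> 0" for u using pos[of r u] r st by auto
    have "(V s has_vector_derivative V s r ** ?G) (at r within {s..t})"
      using V r st unfolding transition_family_def
      by (intro has_vector_derivative_within_subset[where S="{s..1}" and T="{s..t}"]) auto
    then have "((\<lambda>r. V s r $ x $ z) has_vector_derivative (V s r ** ?G) $ x $ z) (at r within {s..t})"
      by (intro bounded_linear.has_vector_derivative[OF bounded_linear_vec_nth])
    then have V': "((\<lambda>r. V s r $ x $ z) has_real_derivative (\<Sum>u\<in>UNIV. V s r $ x $ u * ?G $ u $ z))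
        (at r within {s..t})"
      by (simp add: has_real_derivative_iff_has_vector_derivative matrix_matrix_mult_def)
    have G: "?G $ u $ z = Q $ u $ z * ?p r z / ?p r u
        - (if u = z then (\<Sum>v\<in>UNIV. Q $ z $ v * ?p r v) / ?p r z else 0)" for u
    proof (cases "u = z")
      case True
      have "(\<Sum>v\<in>UNIV. Q $ z $ v * ?p r v) = Q $ z $ z * ?p r z + (\<Sum>v\<in>UNIV - {z}. Q $ z $ v * ?p r v)"
        by (rule sum.remove) auto
      then show ?thesis using True p
        by (simp add: tilted_generator_def tilted_rate_def add_divide_distrib sum_divide_distrib)
    qed (simp add: tilted_generator_def tilted_rate_def)
    have "((\<lambda>r. w r z) has_real_derivative
       ?p s x * (((\<Sum>u\<in>UNIV. V s r $ x $ u * ?G $ u $ z) * ?p r z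
          - V s r $ x $ z * - (\<Sum>v\<in>UNIV. Q $ z $ v * ?p r v)) / (?p r z * ?p r z)))
       (at r within {s..t})"
      unfolding w_def times_divide_eq_right[symmetric]
      by (intro DERIV_cmult DERIV_divide V' space_time_fun_derivative p)
    moreover have "(\<Sum>u\<in>UNIV. V s r $ x $ u * ?G $ u $ z) =
        (\<Sum>u\<in>UNIV. V s r $ x $ u * Q $ u $ z / ?p r u) * ?p r z
         - V s r $ x $ z * (\<Sum>v\<in>UNIV. Q $ z $ v * ?p r v) / ?p r z"
    proof -
      have "(\<Sum>u\<in>UNIV. V s r $ x $ u * ?G $ u $ z) =
          (\<Sum>u\<in>UNIV. V s r $ x $ u * (Q $ u $ z * ?p r z / ?p r u)) -
          (\<Sum>u\<in>UNIV. V s r $ x $ u *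
             (if u = z then (\<Sum>v\<in>UNIV. Q $ z $ v * ?p r v) / ?p r z else 0))"
        unfolding G right_diff_distrib sum_subtractf ..
      moreover have "(\<Sum>u\<in>UNIV. V s r $ x $ u * (Q $ u $ z * ?p r z / ?p r u)) =
          (\<Sum>u\<in>UNIV. V s r $ x $ u * Q $ u $ z / ?p r u) * ?p r z"
        unfolding sum_distrib_right by (simp add: mult_ac)
      ultimately show ?thesis
        by (simp add: if_distrib[where f="\<lambda>a. _ * a"] cong: if_cong)
    qed
    moreover have "a * (((S * q - v * c / q) * q - v * - c) / (q * q)) = a * S"
      if "q \<noteq> 0" for a S q v c :: real
      using that by (simp add: field_simps)
    moreover have "(\<Sum>u\<in>UNIV. w r u * Q $ u $ z) =
        ?p s x * (\<Sum>u\<in>UNIV. V s r $ x $ u * Q $ u $ z / ?p r u)"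
      by (simp add: w_def sum_distrib_left mult_ac)
    ultimately show ?thesis using p[of z] by simp
  qed
  from forward_equation_unique[OF this \<open>s \<le> t\<close>, of y]
  have "w t y = (\<Sum>z\<in>UNIV. w s z * matrix_exp ((t - s) *\<^sub>R Q) $ z $ y)" .
  moreover have "w s z = (if z = x then 1 else 0)" for z
    using V st pos[of s x] by (simp add: w_def transition_family_def mat_def)
  ultimately have "w t y = matrix_exp ((t - s) *\<^sub>R Q) $ x $ y"
    by (simp add: if_distrib[where f="\<lambda>a. a * _"] cong: if_cong)
  then show ?thesis using pos[of s x] pos[of t y] st by (simp add: w_def field_simps)
qed

section \<open>Cylinder events in path space\<close>

lemma space_path_events [simp]: "space (path_events T) = skorokhod_paths"
  unfolding path_events_def by (rule space_measure_of) auto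

lemma sets_path_events:
  "sets (path_events T) =
     sigma_sets skorokhod_paths {{\<omega> \<in> skorokhod_paths. \<omega> t = x} | t x. t \<in> T}"
  unfolding path_events_def by (rule sets_measure_of) auto

lemma coordinate_event:
  "t \<in> T \<Longrightarrow> {\<omega> \<in> skorokhod_paths. \<omega> t = x} \<in> sets (path_events T)"
  unfolding sets_path_events by (intro sigma_sets.Basic) auto

lemma coordinate_measurable:
  "t \<in> T \<Longrightarrow> (\<lambda>\<omega>. \<omega> t :: 'n::finite) \<in> measurable (path_events T) (count_space UNIV)"
  by (auto simp: measurable_count_space_eq2 vimage_def Int_def conj_commute
      intro!: coordinate_event)

text \<open>
  The values prescribed at the times in \<open>J\<close> are given by a function on the whole time axis, so that
  a path can itself serve as the prescription.  Two cylinders that share a path \<open>w\<close> are then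
  cylinders around \<open>w\<close>, which makes their intersection immediate.
\<close>

definition cylinder :: "real set \<Rightarrow> (real \<Rightarrow> 'n) \<Rightarrow> (real \<Rightarrow> 'n) set" where
  "cylinder J v = {\<omega> \<in> skorokhod_paths. \<forall>t\<in>J. \<omega> t = v t}"

definition endpoint_event :: "'n \<Rightarrow> 'n \<Rightarrow> (real \<Rightarrow> 'n) set" where
  "endpoint_event x y = {\<omega> \<in> skorokhod_paths. \<omega> 0 = x \<and> \<omega> 1 = y}"

lemma sets_cylinder:
  assumes "finite J" "J \<subseteq> T"
  shows "cylinder J v \<in> sets (path_events T)"
  using assms
proof (induction J)
  case empty
  then show ?case
    using sets.top[of "path_events T"] by (simp add: cylinder_def)
next
  case (insert t J)
  have "cylinder (insert t J) v = {\<omega> \<in> skorokhod_paths. \<omega> t = v t} \<inter> cylinder J v"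
    by (auto simp: cylinder_def)
  with insert show ?case by (auto intro!: sets.Int coordinate_event)
qed

lemma cylinder_eqI: "w \<in> cylinder J v \<Longrightarrow> cylinder J v = cylinder J w"
  by (auto simp: cylinder_def)

lemma cylinder_Un: "cylinder J w \<inter> cylinder J' w = cylinder (J \<union> J') w"
  by (auto simp: cylinder_def)

lemma endpoint_event_eq: "w \<in> endpoint_event x y \<Longrightarrow> endpoint_event x y = cylinder {0, 1} w"
  by (auto simp: cylinder_def endpoint_event_def)

lemma sets_endpoint_event: "endpoint_event x y \<in> sets path_space"
proof (cases "endpoint_event x y = {}")
  case False
  then obtain w where "w \<in> endpoint_event x y" by auto
  from endpoint_event_eq[OF this] show ?thesis by (simp add: sets_cylinder)
qed simp

lemma path_space_eq_cylinders:
  "sets path_space =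
     sigma_sets skorokhod_paths (insert {} {cylinder J v | J v. finite J \<and> J \<subseteq> {0..1}})"
    (is "_ = sigma_sets _ ?G")
proof (intro equalityI)
  have "{\<omega> \<in> skorokhod_paths. \<omega> t = x} \<in> ?G" if "t \<in> {0..1}" for t x
    using that by (auto simp: cylinder_def intro!: exI[of _ "{t}"] exI[of _ "\<lambda>_. x"])
  then show "sets path_space \<subseteq> sigma_sets skorokhod_paths ?G"
    unfolding sets_path_events by (intro sigma_sets_mono') blast
  show "sigma_sets skorokhod_paths ?G \<subseteq> sets path_space"
    using sets.sigma_sets_subset[of ?G path_space] by (auto intro: sets_cylinder)
qed

lemma Int_stable_cylinders:
  "Int_stable (insert {} {cylinder J v | J v. finite J \<and> J \<subseteq> {0..1}})"
proof (rule Int_stableI)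
  fix A B :: "(real \<Rightarrow> 'n) set"
  let ?G = "insert {} {cylinder J v | J v. finite J \<and> J \<subseteq> {0..1}}"
  assume A: "A \<in> ?G" and B: "B \<in> ?G"
  show "A \<inter> B \<in> ?G"
  proof (cases "A \<inter> B = {}")
    case False
    then obtain w where w: "w \<in> A" "w \<in> B" by auto
    obtain J v where J: "A = cylinder J v" "finite J" "J \<subseteq> {0..1}"
      using A w by auto
    obtain J' v' where J': "B = cylinder J' v'" "finite J'" "J' \<subseteq> {0..1}"
      using B w by auto
    have "A \<inter> B = cylinder (J \<union> J') w"
      using cylinder_eqI[of w J v] cylinder_eqI[of w J' v'] w J(1) J'(1) by (simp add: cylinder_Un)
    with J J' show ?thesis by blast
  qed simp
qed

lemma path_law_space: "path_law P \<Longrightarrow> space P = skorokhod_paths"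
  using sets_eq_imp_space_eq[of P path_space] by (simp add: path_law_def)

lemma path_law_coordinate_measurable:
  fixes P :: "(real \<Rightarrow> 'n::finite) measure"
  assumes "path_law P" "t \<in> {0..1}"
  shows "(\<lambda>\<omega>. \<omega> t) \<in> measurable P (count_space UNIV)"
  using coordinate_measurable[OF assms(2)] assms(1)
    measurable_cong_sets[of P path_space "count_space (UNIV :: 'n set)" "count_space UNIV"]
  by (simp add: path_law_def)

lemma marginal_probability:
  assumes "path_law P" "has_marginal P t (\<mu> :: 'n::finite pmf)" "t \<in> {0..1}"
  shows "measure P {\<omega> \<in> skorokhod_paths. \<omega> t = x} = pmf \<mu> x"
proof -
  note m = path_law_coordinate_measurable[OF assms(1,3)]
  have "pmf \<mu> x = measure (distr P (count_space UNIV) (\<lambda>\<omega>. \<omega> t)) {x}"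
    using assms(2) by (simp add: has_marginal_def pmf.rep_eq)
  also have "\<dots> = measure P {\<omega> \<in> skorokhod_paths. \<omega> t = x}"
    using m path_law_space[OF assms(1)]
    by (subst measure_distr) (auto intro!: arg_cong[where f="measure P"])
  finally show ?thesis ..
qed

lemma has_marginalI:
  fixes \<nu> :: "'n::finite pmf"
  assumes "path_law P" "t \<in> {0..1}"
    and "\<And>x. measure P {\<omega> \<in> skorokhod_paths. \<omega> t = x} = pmf \<nu> x"
  shows "has_marginal P t \<nu>"
proof -
  interpret prob_space P using assms by (simp add: path_law_def)
  note m = path_law_coordinate_measurable[OF assms(1,2)]
  show ?thesis unfolding has_marginal_def
  proof (rule measure_eqI_finite[where A=UNIV])
    fix x
    have "(\<lambda>\<omega>. \<omega> t) -` {x} \<inter> space P = {\<omega> \<in> skorokhod_paths. \<omega> t = x}"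
      using path_law_space[OF assms(1)] by auto
    then show "emeasure (distr P (count_space UNIV) (\<lambda>\<omega>. \<omega> t)) {x} = emeasure (measure_pmf \<nu>) {x}"
      using m assms(3) by (simp add: emeasure_distr emeasure_eq_measure emeasure_pmf_single)
  qed auto
qed

lemma markov_law_transition:
  fixes P :: "(real \<Rightarrow> 'n::finite) measure"
  assumes "markov_law \<mu> G P" "A \<in> sets (path_events {0..s})" "0 \<le> s" "s \<le> t" "t \<le> 1"
  obtains U where "transition_family G U"
    and "measure P {\<omega> \<in> A. \<omega> s = x \<and> \<omega> t = y} = measure P {\<omega> \<in> A. \<omega> s = x} * U s t $ x $ y"
  using assms unfolding markov_law_def by blast

section \<open>Comparing the tilted chain with the reference chain\<close>

text \<open>
  The ratio \<open>\<phi>\<^sub>1(y) / \<phi>\<^sub>0(x)\<close> of the space-time function at the two ends; it is the density of the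
  tilted law with respect to the reference law on \<open>{X\<^sub>0 = x, X\<^sub>1 = y}\<close>.
\<close>

definition endpoint_density :: "real^'n^'n \<Rightarrow> real^'n \<Rightarrow> 'n \<Rightarrow> 'n \<Rightarrow> real" where
  "endpoint_density Q g x y = exp (g $ y) / partition_fun Q g x"

context
  fixes Q :: "real^'n^'n" and \<mu> :: "'n pmf" and R :: "(real \<Rightarrow> 'n) measure"
  assumes \<mu>: "\<And>x. pmf \<mu> x > 0" and R: "markov_law \<mu> (\<lambda>_. Q) R"
begin

lemma reference_step:
  assumes "A \<in> sets (path_events {0..s})" "0 \<le> s" "s \<le> t" "t \<le> 1"
  shows "measure R {\<omega> \<in> A. \<omega> s = x \<and> \<omega> t = y} =
    measure R {\<omega> \<in> A. \<omega> s = x} * matrix_exp ((t - s) *\<^sub>R Q) $ x $ y"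
proof -
  obtain U where "transition_family (\<lambda>_. Q) U"
    and "measure R {\<omega> \<in> A. \<omega> s = x \<and> \<omega> t = y} = measure R {\<omega> \<in> A. \<omega> s = x} * U s t $ x $ y"
    by (rule markov_law_transition[OF R assms])
  then show ?thesis using transition_family_const[of Q U s t] assms by simp
qed

lemma reference_two_times:
  assumes "0 \<le> t" "t \<le> 1"
  shows "measure R {\<omega> \<in> skorokhod_paths. \<omega> 0 = x \<and> \<omega> t = y} =
    pmf \<mu> x * matrix_exp (t *\<^sub>R Q) $ x $ y"
proof -
  have "measure R {\<omega> \<in> skorokhod_paths. \<omega> 0 = x} = pmf \<mu> x"
    using R by (intro marginal_probability) (auto simp: markov_law_def)
  then show ?thesis using reference_step[OF sets.top, of 0 t x y] assms by simp
qed

text \<open>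
  Nonnegativity and stochasticity of \<open>e\<^bsup>tQ\<^esup>\<close> for \<open>t \<in> [0,1]\<close> are read off from the reference law,
  whose two-time probabilities are \<open>\<mu>(x) e\<^bsup>tQ\<^esup>(x,y)\<close>.
\<close>

lemma matrix_exp_nonneg:
  assumes "0 \<le> t" "t \<le> 1"
  shows "matrix_exp (t *\<^sub>R Q) $ x $ y \<ge> 0"
proof -
  have "0 \<le> pmf \<mu> x * matrix_exp (t *\<^sub>R Q) $ x $ y"
    unfolding reference_two_times[OF assms, symmetric] by (rule measure_nonneg)
  then show ?thesis using \<mu>[of x] by (simp add: zero_le_mult_iff)
qed

lemma matrix_exp_row_sum:
  assumes "0 \<le> t" "t \<le> 1"
  shows "(\<Sum>y\<in>UNIV. matrix_exp (t *\<^sub>R Q) $ x $ y) = 1"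
proof -
  have law: "path_law R" "has_marginal R 0 \<mu>" using R by (auto simp: markov_law_def)
  interpret prob_space R using law by (simp add: path_law_def)
  have sets_R: "sets R = sets path_space" using law by (simp add: path_law_def)
  let ?A = "\<lambda>y. {\<omega> \<in> skorokhod_paths. \<omega> 0 = x \<and> \<omega> t = y}"
  have "?A y = {\<omega> \<in> skorokhod_paths. \<omega> 0 = x} \<inter> {\<omega> \<in> skorokhod_paths. \<omega> t = y}" for y by auto
  then have A: "?A y \<in> sets R" for y
    using assms by (auto simp: sets_R intro!: sets.Int coordinate_event)
  have "pmf \<mu> x = measure R (\<Union>y\<in>UNIV. ?A y)"
    unfolding marginal_probability[OF law, of x, simplified, symmetric]
    by (intro arg_cong[where f="measure R"]) auto
  also have "\<dots> = (\<Sum>y\<in>UNIV. measure R (?A y))"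
    by (rule finite_measure_finite_Union) (auto simp: A disjoint_family_on_def)
  also have "\<dots> = pmf \<mu> x * (\<Sum>y\<in>UNIV. matrix_exp (t *\<^sub>R Q) $ x $ y)"
    by (simp add: reference_two_times assms sum_distrib_left)
  finally show ?thesis using \<mu>[of x] by simp
qed

lemma space_time_fun_pos:
  assumes "s \<in> {0..1}"
  shows "space_time_fun Q g s $ x > 0"
proof -
  let ?E = "\<lambda>y. matrix_exp ((1 - s) *\<^sub>R Q) $ x $ y"
  have "0 < (\<Sum>y\<in>UNIV. ?E y * exp (g $ y))"
  proof (rule ccontr)
    assume "\<not> ?thesis"
    moreover have "0 \<le> ?E y" for y using assms by (intro matrix_exp_nonneg) auto
    ultimately have "?E y = 0" for y
      using sum_nonneg_eq_0_iff[of UNIV "\<lambda>y. ?E y * exp (g $ y)"]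
      by (simp add: not_less sum_nonneg order_antisym)
    then show False using matrix_exp_row_sum[of "1 - s" x] assms by simp
  qed
  then show ?thesis by (simp add: space_time_fun_def matrix_vector_mult_def vec_exp_def)
qed

lemma tilted_step:
  assumes P: "markov_law \<mu> (tilted_generator Q g) P"
    and A: "A \<in> sets (path_events {0..s})" "0 \<le> s" "s \<le> t" "t \<le> 1"
  shows "measure P {\<omega> \<in> A. \<omega> s = x \<and> \<omega> t = y} =
    measure P {\<omega> \<in> A. \<omega> s = x} * (matrix_exp ((t - s) *\<^sub>R Q) $ x $ y *
      space_time_fun Q g t $ y / space_time_fun Q g s $ x)"
proof -
  obtain V where V: "transition_family (tilted_generator Q g) V"
    and "measure P {\<omega> \<in> A. \<omega> s = x \<and> \<omega> t = y} = measure P {\<omega> \<in> A. \<omega> s = x} * V s t $ x $ y"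
    by (rule markov_law_transition[OF P A])
  then show ?thesis using transition_family_tilted[OF space_time_fun_pos V A(2-4)] by simp
qed

text \<open>
  Finite-dimensional laws.  Every Markov step from \<open>s\<close> to \<open>t\<close> multiplies the ratio of the two laws
  by \<open>\<phi>\<^sub>t(\<omega>\<^sub>t) / \<phi>\<^sub>s(\<omega>\<^sub>s)\<close>; along an increasing sequence of times the product telescopes.
\<close>

lemma tilted_cylinder:
  assumes P: "markov_law \<mu> (tilted_generator Q g) P"
    and J: "finite J" "J \<subseteq> {0..1}" "0 \<in> J"
  shows "measure P (cylinder J v) = measure R (cylinder J v) *
    (space_time_fun Q g (Max J) $ v (Max J) / space_time_fun Q g 0 $ v 0)"
proof -
  let ?p = "\<lambda>s x. space_time_fun Q g s $ x"
  show ?thesis using J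
  proof (induction J rule: finite_linorder_max_induct)
    case empty
    then show ?case by simp
  next
    case (insert b J)
    show ?case
    proof (cases "J = {}")
      case True
      then have b: "b = 0" using insert.prems by auto
      have "cylinder {0} v = {\<omega> \<in> skorokhod_paths. \<omega> 0 = v 0}" by (auto simp: cylinder_def)
      then have "measure P (cylinder {0} v) = measure R (cylinder {0} v)"
        using marginal_probability[of P 0 \<mu>] marginal_probability[of R 0 \<mu>] P R
        by (simp add: markov_law_def)
      with True b space_time_fun_pos[of 0 g "v 0"] show ?thesis by simp
    next
      case False
      define s where "s = Max J"
      have sJ: "s \<in> J" using False insert.hyps(1) by (simp add: s_def)
      then have "s < b" "s \<in> {0..1}" "b \<in> {0..1}"
        using insert.hyps(2) insert.prems by auto
      then have s: "0 \<le> s" "s \<le> b" "b \<le> 1" by auto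
      have Js: "J \<subseteq> {0..s}" using insert.hyps(1) insert.prems by (auto simp: s_def)
      have Max_b: "Max (insert b J) = b"
        using insert.hyps by (intro Max_eqI) (auto simp: less_imp_le)
      have "b \<noteq> 0" using \<open>s < b\<close> s by simp
      then have zero: "0 \<in> J" using insert.prems by auto
      have "cylinder J v \<in> sets (path_events {0..s})"
        using insert.hyps(1) Js by (rule sets_cylinder)
      note step = reference_step[OF this s, of "v s" "v b"]
        tilted_step[OF P this s, of "v s" "v b"]
      have "{\<omega> \<in> cylinder J v. \<omega> s = v s \<and> \<omega> b = v b} = cylinder (insert b J) v"
        "{\<omega> \<in> cylinder J v. \<omega> s = v s} = cylinder J v"
        using sJ by (auto simp: cylinder_def)
      note step = step[unfolded this]
      have IH: "measure P (cylinder J v) = measure R (cylinder J v) * (?p s (v s) / ?p 0 (v 0))"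
        using insert.IH insert.prems zero by (simp add: s_def)
      have "?p s (v s) \<noteq> 0" using space_time_fun_pos[of s g "v s"] s by auto
      then show ?thesis
        unfolding step IH Max_b by simp
    qed
  qed
qed

lemma partition_fun_pos: "partition_fun Q g x > 0"
  and space_time_fun_0: "space_time_fun Q g 0 $ x = partition_fun Q g x"
  and space_time_fun_1: "space_time_fun Q g 1 $ x = exp (g $ x)"
proof -
  show *: "space_time_fun Q g 0 $ x = partition_fun Q g x"
    by (simp add: space_time_fun_def partition_fun_def matrix_vector_mult_def vec_exp_def)
  show "partition_fun Q g x > 0" using space_time_fun_pos[of 0 g x] by (simp add: *)
  show "space_time_fun Q g 1 $ x = exp (g $ x)"
    by (simp add: space_time_fun_def matrix_exp_0 vec_exp_def)
qed

text \<open>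
  On a cylinder through both endpoints the telescoped ratio depends on the endpoints alone.  After
  intersecting with an endpoint event every cylinder is of this kind (or empty), so both sides agree
  on a generating \<open>\<pi>\<close>-system and hence on all path events.
\<close>

lemma tilted_on_endpoint_event:
  assumes P: "markov_law \<mu> (tilted_generator Q g) P" and B: "B \<in> sets path_space"
  shows "measure P (B \<inter> endpoint_event x y) =
    endpoint_density Q g x y * measure R (B \<inter> endpoint_event x y)"
proof -
  have law: "path_law P" "path_law R" using P R by (auto simp: markov_law_def)
  interpret P: prob_space P using law by (simp add: path_law_def)
  interpret R: prob_space R using law by (simp add: path_law_def)
  have sets_PR: "sets P = sets path_space" "sets R = sets path_space"
    using law by (auto simp: path_law_def)
  let ?E = "endpoint_event x y"
  let ?c = "endpoint_density Q g x y"
  let ?G = "insert {} {cylinder J v | J v. finite J \<and> J \<subseteq> {0..1}} :: (real \<Rightarrow> 'n) set set"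
  have sig: "A \<in> sets P" "A \<in> sets R" if "A \<in> sigma_sets skorokhod_paths ?G" for A
    using that by (simp_all add: sets_PR path_space_eq_cylinders)
  have E: "?E \<in> sets P" "?E \<in> sets R" by (auto simp: sets_PR sets_endpoint_event)
  have cyl: "measure P (cylinder J v \<inter> ?E) = ?c * measure R (cylinder J v \<inter> ?E)"
    if J: "finite J" "J \<subseteq> {0..1}" for J v
  proof (cases "cylinder J v \<inter> ?E = {}")
    case False
    then obtain w where w: "w \<in> cylinder J v" "w \<in> ?E" by auto
    let ?J = "J \<union> {0, 1}"
    have "cylinder J v \<inter> ?E = cylinder ?J w"
      unfolding cylinder_eqI[OF w(1)] endpoint_event_eq[OF w(2)] cylinder_Un ..
    moreover have "Max ?J = 1" using J by (intro Max_eqI) auto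
    moreover have "w 0 = x" "w 1 = y" using w(2) by (auto simp: endpoint_event_def)
    ultimately show ?thesis
      using tilted_cylinder[OF P, of ?J w] J
      by (simp add: space_time_fun_0 space_time_fun_1 endpoint_density_def)
  qed simp
  have B: "B \<in> sigma_sets skorokhod_paths ?G" using B path_space_eq_cylinders by auto
  have sub: "?G \<subseteq> Pow skorokhod_paths" by (auto simp: cylinder_def)
  show ?thesis
  proof (induction rule: sigma_sets_induct_disjoint[OF Int_stable_cylinders sub B])
    case (1 A)
    then show ?case using cyl by auto
  next
    case 2
    then show ?case by simp
  next
    case (3 A)
    \<comment> \<open>The cylinder over no times is the whole path space, so the endpoint event itself is covered.\<close>
    have Om: "cylinder {} undefined \<inter> ?E = ?E" by (auto simp: cylinder_def endpoint_event_def)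
    have eq: "(skorokhod_paths - A) \<inter> ?E = ?E - A \<inter> ?E" by (auto simp: endpoint_event_def)
    have "measure P (?E - A \<inter> ?E) = measure P ?E - measure P (A \<inter> ?E)"
      "measure R (?E - A \<inter> ?E) = measure R ?E - measure R (A \<inter> ?E)"
      using sig[OF 3(1)] E by (auto intro!: P.finite_measure_Diff R.finite_measure_Diff)
    with 3(2) cyl[of "{}" undefined] show ?case
      unfolding eq Om by (simp add: right_diff_distrib)
  next
    case (4 A)
    have m: "range (\<lambda>i. A i \<inter> ?E) \<subseteq> sets P" "range (\<lambda>i. A i \<inter> ?E) \<subseteq> sets R"
      using 4(2) sig E by blast+
    have d: "disjoint_family (\<lambda>i. A i \<inter> ?E)"
      using 4(1) by (auto simp: disjoint_family_on_def)
    have "(\<lambda>i. measure P (A i \<inter> ?E)) sums measure P (\<Union>i. A i \<inter> ?E)"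
      by (rule P.finite_measure_UNION[OF m(1) d])
    moreover have "(\<lambda>i. ?c * measure R (A i \<inter> ?E)) sums (?c * measure R (\<Union>i. A i \<inter> ?E))"
      by (intro sums_mult R.finite_measure_UNION[OF m(2) d])
    ultimately have "measure P (\<Union>i. A i \<inter> ?E) = ?c * measure R (\<Union>i. A i \<inter> ?E)"
      using 4(3) by (simp add: sums_unique2)
    then show ?case by (simp add: UN_simps)
  qed
qed

end

section \<open>Minimal relative entropy\<close>

lemma relative_entropy_density:
  fixes f :: "'a \<Rightarrow> real"
  assumes R: "sigma_finite_measure R" and f: "f \<in> borel_measurable R" "\<And>x. x \<in> space R \<Longrightarrow> 0 \<le> f x"
    and P: "P = density R f"
  shows "relative_entropy P R =
    (if integrable P (\<lambda>x. ln (f x)) then ereal (\<integral>x. ln (f x) \<partial>P) else \<infinity>)"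
proof -
  interpret sigma_finite_measure R by fact
  have [measurable]: "f \<in> borel_measurable P" "(\<lambda>x. enn2real (RN_deriv R P x)) \<in> borel_measurable P"
    using f by (simp_all add: P)
  have ac: "absolutely_continuous R P"
    unfolding P using f(1) by (intro absolutely_continuousI_density) simp
  have "AE x in R. f x = RN_deriv R P x"
    using f by (intro RN_deriv_unique) (simp_all add: P)
  then have "AE x in R. entropy_density (exp 1) R P x = ln (f x)"
    using AE_space by eventually_elim (use f(2) in \<open>auto simp: entropy_density_def log_def
      dest!: sym[of _ "RN_deriv _ _ _"]\<close>)
  then have eq: "AE x in P. entropy_density (exp 1) R P x = ln (f x)"
    using absolutely_continuous_AE[OF _ ac] by (simp add: P)
  have m: "entropy_density (exp 1) R P \<in> borel_measurable P"
    unfolding entropy_density_def comp_def log_def by measurable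
  have "integrable P (entropy_density (exp 1) R P) \<longleftrightarrow> integrable P (\<lambda>x. ln (f x))"
    by (rule integrable_cong_AE[OF m _ eq]) simp
  moreover have "KL_divergence (exp 1) R P = (\<integral>x. ln (f x) \<partial>P)"
    unfolding KL_divergence_def by (rule integral_cong_AE[OF m _ eq]) simp
  ultimately show ?thesis using ac by (simp add: relative_entropy_def)
qed

text \<open>
  If \<open>P = f R\<close> and \<open>P'\<close> has density \<open>h\<close>, then \<open>ln h = ln f + ln (h / f)\<close> and \<open>h / f\<close> is the density of
  \<open>P'\<close> with respect to \<open>P\<close>.  Integrating against \<open>P'\<close> and using that \<open>ln f\<close> has the same mean under
  both laws gives the Pythagorean identity \<open>KL(P' | R) = KL(P | R) + KL(P' | P)\<close>, whose last term is
  positive.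
\<close>

lemma relative_entropy_unique_min:
  fixes f :: "'a \<Rightarrow> real"
  assumes R: "prob_space R" and P: "prob_space P" "P = density R f"
    and f: "f \<in> borel_measurable R" "\<And>x. x \<in> space R \<Longrightarrow> 0 < f x"
    and P': "prob_space P'" "sets P' = sets R" "absolutely_continuous R P'" "P' \<noteq> P"
    and int: "integrable P (\<lambda>x. ln (f x))" "integrable P' (\<lambda>x. ln (f x))"
    and eq: "(\<integral>x. ln (f x) \<partial>P') = (\<integral>x. ln (f x) \<partial>P)"
  shows "relative_entropy P R < relative_entropy P' R"
proof -
  interpret R: prob_space R by fact
  interpret P: prob_space P by fact
  interpret P': prob_space P' by fact
  interpret P: information_space P "exp 1" by standard simp
  \<comment> \<open>\<open>h > 0\<close> holds almost everywhere only for \<open>P'\<close>; where \<open>h = 0\<close> the logarithm has the default value \<open>0\<close>.\<close>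
  obtain h where h: "h \<in> borel_measurable R" "AE x in R. RN_deriv R P' x = ennreal (h x)"
      "\<And>x. 0 \<le> h x" "AE x in P'. 0 < h x"
    using R.real_RN_deriv[OF P'.finite_measure_axioms P'(3,2)] by metis
  have P'h: "P' = density R h"
    using R.density_RN_deriv[OF P'(3,2)] h by (metis (mono_tags) density_cong
      borel_measurable_RN_deriv measurable_compose measurable_ennreal)
  have ent_P: "relative_entropy P R = ereal (\<integral>x. ln (f x) \<partial>P)"
    using relative_entropy_density[OF R.sigma_finite_measure_axioms f(1) _ P(2)] f(2) int(1)
    by (auto simp: less_imp_le)
  have ent_P': "relative_entropy P' R =
      (if integrable P' (\<lambda>x. ln (h x)) then ereal (\<integral>x. ln (h x) \<partial>P') else \<infinity>)"
    by (rule relative_entropy_density[OF R.sigma_finite_measure_axioms h(1,3) P'h])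
  show ?thesis
  proof (cases "integrable P' (\<lambda>x. ln (h x))")
    case True
    let ?D = "\<lambda>x. h x / f x"
    have D: "?D \<in> borel_measurable P" using f h by (simp add: P)
    have nn: "AE x in P. 0 \<le> ?D x"
      using AE_space by eventually_elim (use f h in \<open>auto simp: P less_imp_le\<close>)
    have "AE x in R. f x = 0 \<longrightarrow> h x = 0"
      using f(2) by (intro AE_I2) (metis less_irrefl)
    then have dens: "density P ?D = P'"
      unfolding P(2) P'h using f h
      by (intro density_density_divide) (auto simp: less_imp_le)
    have D': "?D \<in> borel_measurable P'" using f h by (simp add: P'h)
    have fh': "f \<in> borel_measurable P'" "h \<in> borel_measurable P'" using f h by (simp_all add: P'h)
    have sp: "space P' = space R" by (simp add: P'h)
    have ln_D: "AE x in P'. ln (h x) - ln (f x) = ln (?D x)"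
      using h(4) AE_space
    proof eventually_elim
      case (elim x)
      then show ?case using f(2)[of x] sp by (simp add: ln_div)
    qed
    have int_D: "integrable P' (\<lambda>x. ln (?D x))"
      using Bochner_Integration.integrable_diff[OF True int(2)] integrable_cong_AE[OF _ _ ln_D] fh' D'
      by auto
    then have "integrable P (\<lambda>x. ?D x * log (exp 1) (?D x))"
      using integrable_density[of "\<lambda>x. ln (?D x)" P ?D] D nn by (simp add: dens log_def)
    then have "0 < KL_divergence (exp 1) P (density P ?D)"
      using P'(1,4) D nn by (intro P.KL_gt_0) (simp_all only: dens not_False_eq_True)
    also have "\<dots> = (\<integral>x. ?D x * ln (?D x) \<partial>P)"
      using D nn by (subst P.KL_density) (simp_all add: log_def)
    also have "\<dots> = (\<integral>x. ln (?D x) \<partial>P')"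
      using integral_density[of "\<lambda>x. ln (?D x)" P ?D] D nn by (simp add: dens)
    also have "\<dots> = (\<integral>x. ln (h x) - ln (f x) \<partial>P')"
      using fh' D' by (intro integral_cong_AE[symmetric] ln_D) auto
    also have "\<dots> = (\<integral>x. ln (h x) \<partial>P') - (\<integral>x. ln (f x) \<partial>P)"
      using True int(2) by (simp add: eq)
    finally show ?thesis using True by (simp add: ent_P ent_P')
  qed (simp add: ent_P ent_P')
qed

section \<open>The tilted law as a mixture of bridges\<close>

lemma has_marginal_integral:
  fixes h :: "'n::finite \<Rightarrow> real"
  assumes "path_law P" "has_marginal P t \<nu>" "t \<in> {0..1}"
  shows "integrable P (\<lambda>\<omega>. h (\<omega> t))" "(\<integral>\<omega>. h (\<omega> t) \<partial>P) = measure_pmf.expectation \<nu> h"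
proof -
  have m: "(\<lambda>\<omega>. \<omega> t) \<in> measurable P (count_space UNIV)"
    by (rule path_law_coordinate_measurable[OF assms(1,3)])
  have d: "distr P (count_space UNIV) (\<lambda>\<omega>. \<omega> t) = measure_pmf \<nu>"
    using assms(2) by (simp add: has_marginal_def)
  show "integrable P (\<lambda>\<omega>. h (\<omega> t))"
    using integrable_distr_eq[OF m, of h] integrable_measure_pmf_finite[of \<nu> h] by (simp add: d)
  show "(\<integral>\<omega>. h (\<omega> t) \<partial>P) = measure_pmf.expectation \<nu> h"
    using integral_distr[OF m, of h] by (simp add: d)
qed

lemma measure_endpoint_decomposition:
  fixes P :: "(real \<Rightarrow> 'n::finite) measure"
  assumes "path_law P" "A \<in> sets path_space"
  shows "measure P A = (\<Sum>x\<in>UNIV. \<Sum>y\<in>UNIV. measure P (A \<inter> endpoint_event x y))"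
proof -
  interpret prob_space P using assms by (simp add: path_law_def)
  have sets_P: "sets P = sets path_space" using assms by (simp add: path_law_def)
  have "A \<subseteq> skorokhod_paths" using sets.sets_into_space[OF assms(2)] by simp
  then have "A = (\<Union>(x, y)\<in>UNIV. A \<inter> endpoint_event x y)"
    by (auto simp: endpoint_event_def)
  then have "measure P A = measure P (\<Union>(x, y)\<in>UNIV. A \<inter> endpoint_event x y)" by simp
  also have "\<dots> = (\<Sum>(x, y)\<in>UNIV. measure P (A \<inter> endpoint_event x y))"
    unfolding case_prod_beta
  proof (rule finite_measure_finite_Union)
    show "(\<lambda>z. A \<inter> endpoint_event (fst z) (snd z)) ` UNIV \<subseteq> sets P"
      by (auto simp: sets_P intro!: sets.Int assms(2) sets_endpoint_event)
    show "disjoint_family (\<lambda>z. A \<inter> endpoint_event (fst z) (snd z))"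
      by (auto simp: disjoint_family_on_def endpoint_event_def)
  qed simp
  also have "\<dots> = (\<Sum>x\<in>UNIV. \<Sum>y\<in>UNIV. measure P (A \<inter> endpoint_event x y))"
    by (simp add: sum.cartesian_product flip: UNIV_Times_UNIV)
  finally show ?thesis .
qed

context
  fixes Q :: "real^'n^'n" and \<mu> :: "'n pmf" and R P :: "(real \<Rightarrow> 'n) measure" and g :: "real^'n"
  assumes \<mu>: "\<And>x. pmf \<mu> x > 0" and R: "markov_law \<mu> (\<lambda>_. Q) R"
    and P: "markov_law \<mu> (tilted_generator Q g) P"
begin

lemma tilted_law: "path_law P" and reference_law: "path_law R"
  using P R by (auto simp: markov_law_def)

lemma sets_tilted: "sets P = sets path_space" and sets_reference: "sets R = sets path_space"
  using tilted_law reference_law by (auto simp: path_law_def)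

lemma endpoint_density_pos: "endpoint_density Q g x y > 0"
  using partition_fun_pos[OF \<mu> R] by (simp add: endpoint_density_def)

lemma endpoint_density_measurable:
  "(\<lambda>\<omega>. endpoint_density Q g (\<omega> 0) (\<omega> 1)) \<in> borel_measurable R"
proof -
  have m0: "(\<lambda>\<omega>. \<omega> 0) \<in> measurable R (count_space UNIV)"
    and m1: "(\<lambda>\<omega>. \<omega> 1) \<in> measurable R (count_space UNIV)"
    by (auto intro: path_law_coordinate_measurable[OF reference_law])
  show ?thesis
    unfolding endpoint_density_def
    by (intro borel_measurable_divide measurable_compose[OF m0] measurable_compose[OF m1]) auto
qed

lemma reference_endpoints:
  "measure R (endpoint_event x y) = pmf \<mu> x * matrix_exp Q $ x $ y"
  using reference_two_times[OF \<mu> R, of 1 x y] by (simp add: endpoint_event_def)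

lemma tilted_endpoints: "measure P (endpoint_event x y) = coupling Q \<mu> g x y"
  using tilted_on_endpoint_event[OF \<mu> R P sets_endpoint_event, of x y x y]
  by (simp add: reference_endpoints coupling_def tilted_kernel_def endpoint_density_def)

lemma tilted_eq_density: "P = density R (\<lambda>\<omega>. endpoint_density Q g (\<omega> 0) (\<omega> 1))"
proof (rule measure_eqI)
  interpret P: prob_space P using tilted_law by (simp add: path_law_def)
  interpret R: prob_space R using reference_law by (simp add: path_law_def)
  show "sets P = sets (density R (\<lambda>\<omega>. endpoint_density Q g (\<omega> 0) (\<omega> 1)))"
    by (simp add: sets_tilted sets_reference)
  fix A assume "A \<in> sets P"
  then have A: "A \<in> sets path_space" by (simp add: sets_tilted)
  then have AE: "A \<inter> endpoint_event x y \<in> sets R" for x y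
    by (simp add: sets_reference sets.Int sets_endpoint_event)
  have m: "(\<lambda>\<omega>. endpoint_density Q g (\<omega> 0) (\<omega> 1)) \<in> borel_measurable R"
    by (rule endpoint_density_measurable)
  have sp: "A \<subseteq> skorokhod_paths" using sets.sets_into_space[OF A] by simp
  have "ennreal (endpoint_density Q g (\<omega> 0) (\<omega> 1)) * indicator A \<omega> =
      (\<Sum>x\<in>UNIV. \<Sum>y\<in>UNIV. ennreal (endpoint_density Q g x y) * indicator (A \<inter> endpoint_event x y) \<omega>)" for \<omega>
  proof -
    have "ennreal (endpoint_density Q g x y) * indicator (A \<inter> endpoint_event x y) \<omega> =
        (if y = \<omega> 1 then if x = \<omega> 0 then ennreal (endpoint_density Q g x y) * indicator A \<omega> else 0 else 0)" for x y
      using sp by (auto simp: indicator_def endpoint_event_def)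
    then show ?thesis by simp
  qed
  then have "emeasure (density R (\<lambda>\<omega>. endpoint_density Q g (\<omega> 0) (\<omega> 1))) A =
      (\<integral>\<^sup>+\<omega>. (\<Sum>x\<in>UNIV. \<Sum>y\<in>UNIV. ennreal (endpoint_density Q g x y) * indicator (A \<inter> endpoint_event x y) \<omega>) \<partial>R)"
    using m A by (subst emeasure_density) (auto simp: sets_reference)
  also have "\<dots> = (\<Sum>x\<in>UNIV. \<Sum>y\<in>UNIV. ennreal (endpoint_density Q g x y) * emeasure R (A \<inter> endpoint_event x y))"
    by (intro trans[OF nn_integral_sum] sum.cong refl nn_integral_cmult_indicator AE
        borel_measurable_sum borel_measurable_times_ennreal borel_measurable_const
        borel_measurable_indicator)
  also have "\<dots> = ennreal (\<Sum>x\<in>UNIV. \<Sum>y\<in>UNIV. endpoint_density Q g x y * measure R (A \<inter> endpoint_event x y))"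
    using less_imp_le[OF endpoint_density_pos]
    by (simp add: R.emeasure_eq_measure sum_nonneg flip: ennreal_mult sum_ennreal)
  also have "\<dots> = emeasure P A"
    unfolding P.emeasure_eq_measure measure_endpoint_decomposition[OF tilted_law A]
    by (simp add: tilted_on_endpoint_event[OF \<mu> R P A])
  finally show "emeasure P A = emeasure (density R (\<lambda>\<omega>. endpoint_density Q g (\<omega> 0) (\<omega> 1))) A" ..
qed

lemma bridge_tilted:
  assumes K: "matrix_exp Q $ x $ y > 0"
  shows "bridge P x y = bridge R x y"
proof (rule measure_eqI)
  show sets: "sets (bridge P x y) = sets (bridge R x y)"
    by (simp add: bridge_def sets_tilted sets_reference)
  fix A assume "A \<in> sets (bridge P x y)"
  then have A: "A \<in> sets path_space" by (simp add: bridge_def sets_tilted)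
  interpret P: prob_space P using tilted_law by (simp add: path_law_def)
  interpret R: prob_space R using reference_law by (simp add: path_law_def)
  let ?E = "endpoint_event x y" and ?c = "endpoint_density Q g x y"
  have RE: "measure R ?E > 0" using K \<mu>[of x] by (simp add: reference_endpoints)
  have "emeasure P (?E \<inter> A) / emeasure P ?E = emeasure R (?E \<inter> A) / emeasure R ?E"
    using tilted_on_endpoint_event[OF \<mu> R P A, of x y] RE endpoint_density_pos[of x y]
      tilted_on_endpoint_event[OF \<mu> R P sets_endpoint_event, of x y x y]
    by (simp add: P.emeasure_eq_measure R.emeasure_eq_measure divide_ennreal Int_commute)
  then show "emeasure (bridge P x y) A = emeasure (bridge R x y) A"
    unfolding bridge_def path_law_space[OF tilted_law] path_law_space[OF reference_law]
      endpoint_event_def[symmetric]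
    using A by (simp add: sets_tilted sets_reference sets_endpoint_event)
qed

lemma tilted_mixture:
  assumes K: "\<And>x y. matrix_exp Q $ x $ y > 0" and A: "A \<in> sets path_space"
  shows "measure P A = (\<Sum>x\<in>UNIV. \<Sum>y\<in>UNIV. coupling Q \<mu> g x y * measure (bridge R x y) A)"
proof -
  interpret R: prob_space R using reference_law by (simp add: path_law_def)
  have "coupling Q \<mu> g x y * measure (bridge R x y) A = measure P (A \<inter> endpoint_event x y)" for x y
  proof -
    have RE: "measure R (endpoint_event x y) > 0"
      using K[of x y] \<mu>[of x] by (simp add: reference_endpoints)
    then have "measure (bridge R x y) A =
        measure R (endpoint_event x y \<inter> A) / measure R (endpoint_event x y)"
      unfolding bridge_def path_law_space[OF reference_law] endpoint_event_def[symmetric]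
      using A by (intro measure_uniform_measure) (auto simp: R.emeasure_eq_measure sets_reference)
    then show ?thesis
      using tilted_on_endpoint_event[OF \<mu> R P A, of x y] RE
        tilted_on_endpoint_event[OF \<mu> R P sets_endpoint_event, of x y x y]
      by (simp add: tilted_endpoints[symmetric] Int_commute)
  qed
  then show ?thesis by (simp add: measure_endpoint_decomposition[OF tilted_law A])
qed

lemma tilted_final_marginal:
  assumes "\<And>y. second_marginal Q \<mu> g y = pmf \<nu> y"
  shows "has_marginal P 1 \<nu>"
proof (rule has_marginalI[OF tilted_law])
  fix y :: 'n
  let ?A = "{\<omega> \<in> skorokhod_paths. \<omega> 1 = y}"
  have "?A \<inter> endpoint_event x z = (if z = y then endpoint_event x y else {})" for x z
    by (auto simp: endpoint_event_def)
  then have "measure P ?A = (\<Sum>x\<in>UNIV. \<Sum>z\<in>UNIV. if z = y then coupling Q \<mu> g x y else 0)"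
    by (subst measure_endpoint_decomposition[OF tilted_law coordinate_event])
       (auto intro!: sum.cong simp: tilted_endpoints if_distrib[where f="measure P"] cong: if_cong)
  then show "measure P ?A = pmf \<nu> y"
    using assms[of y] by (simp add: second_marginal_def)
qed auto

text \<open>
  The log-density \<open>g(X\<^sub>1) - ln Z\<^sub>g(X\<^sub>0)\<close> is a sum of a function of \<open>X\<^sub>1\<close> and a function of \<open>X\<^sub>0\<close>, so its mean
  is determined by the two endpoint marginals and is the same for all candidates.
\<close>

lemma tilted_schroedinger_bridge:
  assumes \<nu>: "\<And>y. second_marginal Q \<mu> g y = pmf \<nu> y"
  shows "schroedinger_bridge R \<mu> \<nu> P"
proof -
  let ?f = "\<lambda>\<omega>. endpoint_density Q g (\<omega> 0) (\<omega> 1)"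
  have prob: "prob_space P" "prob_space R"
    using tilted_law reference_law by (auto simp: path_law_def)
  note f = endpoint_density_measurable
  have ac: "absolutely_continuous R P"
    using f by (subst tilted_eq_density) (auto intro: absolutely_continuousI_density)
  have P_cand: "P \<in> bridge_candidates R \<mu> \<nu>"
    unfolding bridge_candidates_def
    using tilted_law P tilted_final_marginal[OF \<nu>] ac by (simp add: markov_law_def)
  let ?I = "measure_pmf.expectation \<nu> (\<lambda>y. g $ y) - measure_pmf.expectation \<mu> (\<lambda>x. ln (partition_fun Q g x))"
  have ln_f: "ln (?f \<omega>) = g $ \<omega> 1 - ln (partition_fun Q g (\<omega> 0))" for \<omega>
    using partition_fun_pos[OF \<mu> R, of g "\<omega> 0"] by (simp add: endpoint_density_def ln_div)
  have int: "integrable P' (\<lambda>\<omega>. ln (?f \<omega>))" "(\<integral>\<omega>. ln (?f \<omega>) \<partial>P') = ?I"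
    if "P' \<in> bridge_candidates R \<mu> \<nu>" for P'
  proof -
    have law: "path_law P'" "has_marginal P' 0 \<mu>" "has_marginal P' 1 \<nu>"
      using that by (auto simp: bridge_candidates_def)
    note i0 = has_marginal_integral[OF law(1,2), of "\<lambda>x. ln (partition_fun Q g x)"]
    note i1 = has_marginal_integral[OF law(1,3), of "\<lambda>y. g $ y"]
    show "integrable P' (\<lambda>\<omega>. ln (?f \<omega>))" "(\<integral>\<omega>. ln (?f \<omega>) \<partial>P') = ?I"
      unfolding ln_f using i0 i1 by simp_all
  qed
  have "relative_entropy P R < relative_entropy P' R"
    if P': "P' \<in> bridge_candidates R \<mu> \<nu>" "P' \<noteq> P" for P'
  proof (rule relative_entropy_unique_min[OF prob(2,1) tilted_eq_density f])
    show "prob_space P'" "sets P' = sets R" "absolutely_continuous R P'" "P' \<noteq> P"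
      using P' by (auto simp: bridge_candidates_def path_law_def sets_reference)
    show "integrable P (\<lambda>\<omega>. ln (?f \<omega>))" by (rule int(1)[OF P_cand])
    show "integrable P' (\<lambda>\<omega>. ln (?f \<omega>))" by (rule int(1)[OF P'(1)])
    show "(\<integral>\<omega>. ln (?f \<omega>) \<partial>P') = (\<integral>\<omega>. ln (?f \<omega>) \<partial>P)"
      by (rule trans[OF int(2)[OF P'(1)] int(2)[OF P_cand, symmetric]])
  qed (rule endpoint_density_pos)
  with P_cand show ?thesis unfolding schroedinger_bridge_def by blast
qed

end

theorem mainTheorem10:
  fixes Q :: "real^'n^'n" and \<mu> \<nu> :: "'n pmf" and g :: "real^'n"
    and R P :: "(real \<Rightarrow> 'n) measure"
  assumes "is_generator Q"
    and "\<And>x y. matrix_exp Q $ x $ y > 0"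
    and "\<And>x. pmf \<mu> x > 0"
    and "\<And>y. pmf \<nu> y > 0"
    and "markov_law \<mu> (\<lambda>_. Q) R"
    and "markov_law \<mu> (tilted_generator Q g) P"
  shows "(\<forall>s\<in>{0..1}. \<forall>x. space_time_fun Q g s $ x > 0) \<and>
    (\<forall>x y. measure P {\<omega> \<in> space P. \<omega> 0 = x \<and> \<omega> 1 = y} = coupling Q \<mu> g x y) \<and>
    (\<forall>x y. bridge P x y = bridge R x y) \<and>
    (\<forall>A\<in>sets path_space.
       measure P A = (\<Sum>x\<in>UNIV. \<Sum>y\<in>UNIV. coupling Q \<mu> g x y * measure (bridge R x y) A)) \<and>
    (g \<in> gauge_space \<nu> \<and> (\<forall>y. second_marginal Q \<mu> g y = pmf \<nu> y) \<longrightarrow>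
       schroedinger_bridge R \<mu> \<nu> P)"
proof (intro conjI ballI allI impI)
  note K = assms(2) and chains = assms(3,5) and tilted = assms(3,5,6)
  have law: "path_law P" using assms(6) by (simp add: markov_law_def)
  show "space_time_fun Q g s $ x > 0" if "s \<in> {0..1}" for s x
    by (rule space_time_fun_pos[OF chains that])
  show "measure P {\<omega> \<in> space P. \<omega> 0 = x \<and> \<omega> 1 = y} = coupling Q \<mu> g x y" for x y
    using tilted_endpoints[OF tilted, of x y]
    by (simp add: endpoint_event_def path_law_space[OF law])
  show "bridge P x y = bridge R x y" for x y
    by (rule bridge_tilted[OF tilted K])
  show "measure P A = (\<Sum>x\<in>UNIV. \<Sum>y\<in>UNIV. coupling Q \<mu> g x y * measure (bridge R x y) A)"
    if "A \<in> sets path_space" for A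
    by (rule tilted_mixture[OF tilted K that])
  show "schroedinger_bridge R \<mu> \<nu> P"
    if "g \<in> gauge_space \<nu> \<and> (\<forall>y. second_marginal Q \<mu> g y = pmf \<nu> y)"
    using that by (intro tilted_schroedinger_bridge[OF tilted]) auto
qed

end
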